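(* Let $\mu>0$ and $0\le\delta<2$, and let $\mathcal{P}(\mu,\delta\mu)$ be the set of all distributions on $\mathbb{R}$ with mean $\mu$ and mean absolute deviation $\delta\mu$. Then the optimal robust selling price $\rho=r/\mu$ solving $$\min_{r}\ \sup_{\mathbb{P}\in\mathcal{P}(\mu,\delta\mu)}\frac{\mathrm{OPT}(\mathbb{P})}{\mathrm{REV}(r,\mathbb{P})}$$ is $$\rho=\begin{cases}\dfrac{4+\delta-\sqrt{\delta^2+8\delta}}{4} & \text{if } 0\le\delta\le 2(\sqrt5-2),\\[2mm] \dfrac{2-\delta}{2+\delta} & \text{if } 2(\sqrt5-2)\le\delta<2,\end{cases}$$ and the resulting ratio is $$\min_{\rho}\ \sup_{\mathbb{P}\in\mathcal{P}(\mu,\delta\mu)}\frac{\mathrm{OPT}(\mathbb{P})}{\mathrm{REV}(\rho\mu,\mathbb{P})}=1+\begin{cases}\dfrac{2\delta}{\sqrt{\delta^2+8\delta}-3\delta} & \text{if } 0\le\delta\le 2(\sqrt5-2),\\[2mm] \dfrac{8\delta}{(2-\delta)^2} & \text{if } 2(\sqrt5-2)\le\delta<2,\end{cases}$$ where for $\delta=0$ the first fraction is read as its limiting value $0$.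
   Context: $\mathcal{P}(\mu,\delta\mu)$ consists of all probability distributions $\mathbb{P}$ on $\mathbb{R}$ with $\mathbb{E}_{\mathbb{P}}(X)=\mu$ and $\mathbb{E}_{\mathbb{P}}(|X-\mu|)=\delta\mu$ for $X\sim\mathbb{P}$. For a price $r>0$ and a demand distribution $\mathbb{P}$, the expected revenue is $\mathrm{REV}(r,\mathbb{P})=r\,\mathbb{P}(X\ge r)$, and $\mathrm{OPT}(\mathbb{P})=\max_{r'}\mathrm{REV}(r',\mathbb{P})$. The ratio is taken to be $+\infty$ when $\mathrm{REV}(r,\mathbb{P})=0$. *)

theory Defs
  imports "HOL-Probability.Probability"
begin

text \<open>
  Integrability of the identity is required explicitly because the Bochner integral of a
  non-integrable function is 0; it also makes the mean absolute deviation finite.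
\<close>

definition mean_MAD_set :: "real \<Rightarrow> real \<Rightarrow> real measure set" where
  "mean_MAD_set \<mu> d =
     {P. real_distribution P \<and> integrable P (\<lambda>x. x) \<and>
         (LINT x|P. x) = \<mu> \<and> (LINT x|P. \<bar>x - \<mu>\<bar>) = d}"

definition REV :: "real \<Rightarrow> real measure \<Rightarrow> real" where
  "REV r P = r * measure P {r..}"

text \<open>
  The maximal revenue over all positive prices, written as a supremum in the extended reals.
  For a distribution with finite positive mean the supremum is attained: the revenue is upper
  semicontinuous in the price, vanishes as the price tends to 0 or to infinity, and is
  positive at some price.
\<close>

definition OPT :: "real measure \<Rightarrow> ereal" where
  "OPT P = (SUP r\<in>{0<..}. ereal (REV r P))"

definition OPT_REV_ratio :: "real \<Rightarrow> real measure \<Rightarrow> ereal" where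
  "OPT_REV_ratio r P = (if REV r P = 0 then \<infinity> else OPT P / ereal (REV r P))"

definition worst_case_ratio :: "real \<Rightarrow> real \<Rightarrow> real \<Rightarrow> ereal" where
  "worst_case_ratio \<mu> d r = (SUP P\<in>mean_MAD_set \<mu> d. OPT_REV_ratio r P)"

end

theory Submission
  imports Defs
begin

text \<open>
  Measure prices in units of the mean, \<open>r = \<rho> * \<mu>\<close>, and let \<open>q\<close> be the probability of a sale at
  that price. The theorem follows from an exact formula for the worst-case ratio as a function
  of \<open>\<rho>\<close>, which is then minimised by calculus-free algebra.

  Mean and mean absolute deviation together say that the positive and the negative part of
  \<open>X - \<mu>\<close> both have expectation \<open>\<delta> * \<mu> / 2\<close>. The negative part limits how much mass can lie below
  a price \<open>\<rho> * \<mu>\<close> with \<open>\<rho> < 1\<close>, so \<open>q\<close> is at least \<open>\<kappa> = 1 - \<delta> / (2 * (1 - \<rho>))\<close>. The positive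
  part limits what the optimal price can earn. An optimal price below \<open>r\<close> earns at most itself,
  hence less than \<open>\<rho> * \<mu>\<close>; an optimal price \<open>s \<ge> r\<close> earns at most \<open>\<mu> * q + \<delta> * \<mu> / 2\<close>, because
  \<open>s\<close> on the event \<open>X \<ge> s\<close> is dominated by \<open>\<mu>\<close> on \<open>X \<ge> r\<close> plus the positive part of \<open>X - \<mu>\<close>.
  Dividing by the revenue \<open>\<rho> * \<mu> * q\<close> and using \<open>q \<ge> \<kappa>\<close> bounds the ratio by the larger of
  \<open>1 / \<kappa>\<close> and \<open>(\<kappa> + \<delta> / 2) / (\<rho> * \<kappa>)\<close> (lemma \<open>worst_case_ratio_le\<close>).

  For \<open>\<delta> > 0\<close> both bounds are approached by one family of distributions: mass \<open>q\<close> slightly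
  above \<open>\<kappa>\<close> at \<open>\<mu> * (1 + \<delta> / (2 * q))\<close> and the rest at \<open>\<mu> * (1 - \<delta> / (2 * (1 - q)))\<close>, a point
  just below \<open>r\<close>. The optimal seller can then serve everybody at almost the price \<open>r\<close>, or
  serve only the upper point. If \<open>\<rho> \<ge> 1 - \<delta> / 2\<close> the same family, with \<open>q\<close> tending to \<open>0\<close>,
  makes the ratio infinite (lemmas \<open>worst_case_ratio_ge\<close> and \<open>worst_case_ratio_infinite\<close>).

  It remains to minimise the larger of two functions of \<open>\<rho>\<close>. The ratio \<open>1 / \<kappa>\<close> against lower
  prices increases. The ratio against higher prices has its unique minimum at
  \<open>(2 - \<delta>) / (2 + \<delta>)\<close>, and it is at least as large as the other exactly when \<open>\<delta> * \<rho> \<le> 2 * (1 - \<rho>)\<^sup>2\<close>,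
  that is, up to the crossing point \<open>(4 + \<delta> - sqrt (\<delta>\<^sup>2 + 8 * \<delta>)) / 4\<close>. Hence the optimum is
  whichever of these two points comes first, and they coincide when
  \<open>\<delta>\<^sup>2 + 8 * \<delta> = 4\<close>, that is, \<open>\<delta> = 2 * (sqrt 5 - 2)\<close>. For \<open>\<delta> = 0\<close> demand is almost surely
  \<open>\<mu>\<close>, the price \<open>\<mu>\<close> is itself optimal, and this case is treated separately since then
  \<open>\<rho> = 1\<close> lies at the edge of the range \<open>\<rho> < 1 - \<delta> / 2\<close>.
\<close>

section \<open>Bounds valid for every distribution\<close>

lemma mean_MAD_setD:
  assumes "P \<in> mean_MAD_set \<mu> d"
  shows "real_distribution P" "integrable P (\<lambda>x. x)"
    "(LINT x|P. x) = \<mu>" "(LINT x|P. \<bar>x - \<mu>\<bar>) = d"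
  using assms by (auto simp: mean_MAD_set_def)

lemma integral_positive_and_negative_part:
  assumes "P \<in> mean_MAD_set \<mu> d"
  shows "integrable P (\<lambda>x. max 0 (x - \<mu>))" "(LINT x|P. max 0 (x - \<mu>)) = d / 2"
    and "integrable P (\<lambda>x. max 0 (\<mu> - x))" "(LINT x|P. max 0 (\<mu> - x)) = d / 2"
proof -
  note P = mean_MAD_setD[OF assms]
  interpret real_distribution P by (rule P(1))
  have int: "integrable P (\<lambda>x. x - \<mu>)" "integrable P (\<lambda>x. \<bar>x - \<mu>\<bar>)"
    using P(2) by auto
  have centred: "(LINT x|P. x - \<mu>) = 0"
    using P(2,3) prob_space by simp
  have pos: "max 0 (x - \<mu>) = (\<bar>x - \<mu>\<bar> + (x - \<mu>)) / 2"
    and neg: "max 0 (\<mu> - x) = (\<bar>x - \<mu>\<bar> - (x - \<mu>)) / 2" for x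
    by (auto simp: max_def)
  show "integrable P (\<lambda>x. max 0 (x - \<mu>))" "integrable P (\<lambda>x. max 0 (\<mu> - x))"
    unfolding pos neg using int by auto
  have "(LINT x|P. max 0 (x - \<mu>)) = ((LINT x|P. \<bar>x - \<mu>\<bar>) + (LINT x|P. x - \<mu>)) / 2"
    unfolding pos using int by (simp del: Bochner_Integration.integral_diff)
  then show "(LINT x|P. max 0 (x - \<mu>)) = d / 2"
    using centred P(4) by simp
  have "(LINT x|P. max 0 (\<mu> - x)) = ((LINT x|P. \<bar>x - \<mu>\<bar>) - (LINT x|P. x - \<mu>)) / 2"
    unfolding neg using int
    by (simp only: Bochner_Integration.integral_diff integral_divide_zero)
  then show "(LINT x|P. max 0 (\<mu> - x)) = d / 2"
    using centred P(4) by simp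
qed

text \<open>
  Every sale lost at a price below the mean costs at least \<open>\<mu> - r\<close> of the negative part of
  \<open>X - \<mu>\<close>, and the expectation of that part is fixed.
\<close>

lemma sale_probability_lower_bound:
  assumes P: "P \<in> mean_MAD_set \<mu> d" and "r < \<mu>"
  shows "1 - d / (2 * (\<mu> - r)) \<le> measure P {r..}"
proof -
  interpret real_distribution P by (rule mean_MAD_setD(1)[OF P])
  have "(\<mu> - r) * measure P {..<r} = (LINT x|P. (\<mu> - r) * indicator {..<r} x)"
    by simp
  also have "\<dots> \<le> (LINT x|P. max 0 (\<mu> - x))"
  proof (rule integral_mono)
    show "integrable P (\<lambda>x. (\<mu> - r) * indicator {..<r} x)"
      by (simp add: emeasure_eq_measure)
  qed (use integral_positive_and_negative_part(3)[OF P] assms(2) in \<open>auto simp: indicator_def\<close>)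
  also have "\<dots> = d / 2"
    by (rule integral_positive_and_negative_part(4)[OF P])
  finally have *: "measure P {..<r} \<le> d / (2 * (\<mu> - r))"
    using assms(2) by (simp add: field_simps)
  have "measure P {r..} = 1 - measure P {..<r}"
    using prob_compl[of "{..<r}"] by (simp add: Compl_eq_Diff_UNIV[symmetric])
  with * show ?thesis by simp
qed

text \<open>
  A case distinction on \<open>s \<le> \<mu>\<close> is avoided by a pointwise bound: where \<open>x \<ge> s\<close>, the price \<open>s\<close>
  is at most \<open>x \<le> \<mu> + max 0 (x - \<mu>)\<close>.
\<close>

lemma REV_higher_price_le:
  assumes P: "P \<in> mean_MAD_set \<mu> d" and "0 \<le> \<mu>" and "r \<le> s"
  shows "REV s P \<le> \<mu> * measure P {r..} + d / 2"
proof -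
  interpret real_distribution P by (rule mean_MAD_setD(1)[OF P])
  note part = integral_positive_and_negative_part(1,2)[OF P]
  have "REV s P = (LINT x|P. s * indicator {s..} x)"
    by (simp add: REV_def)
  also have "\<dots> \<le> (LINT x|P. \<mu> * indicator {r..} x + max 0 (x - \<mu>))"
  proof (rule integral_mono)
    show "integrable P (\<lambda>x. s * indicator {s..} x)"
      by (simp add: emeasure_eq_measure)
    show "integrable P (\<lambda>x. \<mu> * indicator {r..} x + max 0 (x - \<mu>))"
      using part(1) by (simp add: emeasure_eq_measure)
  qed (use assms(2,3) in \<open>auto simp: indicator_def\<close>)
  also have "\<dots> = \<mu> * measure P {r..} + d / 2"
    using part by (simp add: emeasure_eq_measure)
  finally show ?thesis .
qed

text \<open>
  Prices below \<open>r\<close> need only the trivial bound that revenue is at most the price.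
\<close>

lemma OPT_le:
  assumes P: "P \<in> mean_MAD_set \<mu> d" and "0 \<le> \<mu>"
  shows "OPT P \<le> ereal (max r (\<mu> * measure P {r..} + d / 2))"
  unfolding OPT_def
proof (rule SUP_least)
  fix s :: real assume s: "s \<in> {0<..}"
  interpret real_distribution P by (rule mean_MAD_setD(1)[OF P])
  show "ereal (REV s P) \<le> ereal (max r (\<mu> * measure P {r..} + d / 2))"
  proof (cases "r \<le> s")
    case True
    then show ?thesis using REV_higher_price_le[OF assms True] by (simp add: le_max_iff_disj)
  next
    case False
    have "REV s P \<le> s" unfolding REV_def using s by (simp add: mult_left_le)
    then show ?thesis using False by (simp add: le_max_iff_disj)
  qed
qed

section \<open>Extremal two-point distributions\<close>

text \<open>
  Mass \<open>q\<close> at the high value \<open>h\<close> and mass \<open>1 - q\<close> at the low value \<open>l\<close>, pushed forward to the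
  Borel sets from a Bernoulli variable so that integrals become two-term sums.
\<close>

definition two_point :: "real \<Rightarrow> real \<Rightarrow> real \<Rightarrow> real measure" where
  "two_point q h l = distr (measure_pmf (bernoulli_pmf q)) borel (\<lambda>b. if b then h else l)"

lemma real_distribution_two_point: "real_distribution (two_point q h l)"
  unfolding two_point_def
  by (rule prob_space.real_distribution_distr) (auto simp: measure_pmf.prob_space_axioms)

lemma integral_two_point:
  fixes f :: "real \<Rightarrow> real"
  assumes "0 \<le> q" "q \<le> 1" and [measurable]: "f \<in> borel_measurable borel"
  shows "integrable (two_point q h l) f"
    and "(LINT x|two_point q h l. f x) = q * f h + (1 - q) * f l"
proof -
  show "integrable (two_point q h l) f"
    unfolding two_point_def
    by (subst integrable_distr_eq) (auto intro!: integrable_measure_pmf_finite)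
  show "(LINT x|two_point q h l. f x) = q * f h + (1 - q) * f l"
    unfolding two_point_def using assms(1,2) by (subst integral_distr) auto
qed

lemma measure_two_point:
  assumes "0 \<le> q" "q \<le> 1" and "A \<in> sets borel"
  shows "measure (two_point q h l) A = q * indicator A h + (1 - q) * indicator A l"
proof -
  interpret real_distribution "two_point q h l" by (rule real_distribution_two_point)
  have "measure (two_point q h l) A = (LINT x|two_point q h l. indicator A x)"
    using assms(3) by simp
  then show ?thesis
    using integral_two_point(2)[OF assms(1,2), of "indicator A" h l] assms(3) by simp
qed

text \<open>
  Given the upper mass \<open>q\<close>, the constraints leave no freedom: each of the two points must
  contribute half of the mean absolute deviation.
\<close>

lemma two_point_in_mean_MAD_set:
  fixes \<mu> \<delta> q :: real
  assumes "0 \<le> \<mu>" "0 \<le> \<delta>" "0 < q" "q < 1"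
  defines "h \<equiv> \<mu> * (1 + \<delta> / (2 * q))" and "l \<equiv> \<mu> * (1 - \<delta> / (2 * (1 - q)))"
  shows "two_point q h l \<in> mean_MAD_set \<mu> (\<delta> * \<mu>)"
proof -
  have h: "h - \<mu> = \<mu> * \<delta> / (2 * q)" and l: "l - \<mu> = - (\<mu> * \<delta> / (2 * (1 - q)))"
    by (simp_all add: h_def l_def algebra_simps)
  have mean: "q * h + (1 - q) * l = \<mu>"
    unfolding h_def l_def using assms(3,4) by (simp add: field_simps)
  have "\<bar>h - \<mu>\<bar> = \<mu> * \<delta> / (2 * q)" "\<bar>l - \<mu>\<bar> = \<mu> * \<delta> / (2 * (1 - q))"
    unfolding h l using assms(1-4) by simp_all
  then have MAD: "q * \<bar>h - \<mu>\<bar> + (1 - q) * \<bar>l - \<mu>\<bar> = \<delta> * \<mu>"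
    using assms(3,4) by (simp add: field_simps)
  show ?thesis
    unfolding mean_MAD_set_def
    using assms(3,4) mean MAD by (auto simp: real_distribution_two_point integral_two_point)
qed

text \<open>
  The case of zero revenue is included, where the ratio is infinite by convention; this lets the
  extremal distributions be used without knowing whether the upper point reaches the price.
\<close>

lemma ratio_ge_of_REV_ge:
  assumes "0 < s" "0 \<le> REV r P" "REV r P \<le> b" "0 < b" "a \<le> REV s P" "0 \<le> a"
  shows "ereal (a / b) \<le> OPT_REV_ratio r P"
proof (cases "REV r P = 0")
  case True
  then show ?thesis by (simp add: OPT_REV_ratio_def)
next
  case False
  then have pos: "0 < REV r P" using assms(2) by simp
  have "ereal (a / b) \<le> ereal (REV s P / REV r P)"
    using assms pos by (simp add: frac_le)
  also have "\<dots> = ereal (REV s P) / ereal (REV r P)"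
    using pos by simp
  also have "\<dots> \<le> OPT P / ereal (REV r P)"
    using pos assms(1) unfolding OPT_def
    by (intro ereal_divide_right_mono SUP_upper) auto
  finally show ?thesis using False by (simp add: OPT_REV_ratio_def)
qed

text \<open>
  When the lower point lies below the price, the seller reaches at most the mass \<open>q\<close>. The two
  bounds come from comparing with the upper and with the lower point as the alternative price.
\<close>

lemma worst_case_ratio_ge_two_point:
  fixes \<mu> \<delta> q \<rho> :: real
  assumes "0 < \<mu>" "0 \<le> \<delta>" "0 < q" "q < 1" "0 < \<rho>" and low: "1 - \<delta> / (2 * (1 - q)) < \<rho>"
  shows "ereal ((q + \<delta> / 2) / (\<rho> * q)) \<le> worst_case_ratio \<mu> (\<delta> * \<mu>) (\<rho> * \<mu>)"
    and "0 < 1 - \<delta> / (2 * (1 - q)) \<Longrightarrow>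
      ereal ((1 - \<delta> / (2 * (1 - q))) / (\<rho> * q)) \<le> worst_case_ratio \<mu> (\<delta> * \<mu>) (\<rho> * \<mu>)"
proof -
  define h where "h = \<mu> * (1 + \<delta> / (2 * q))"
  define l where "l = \<mu> * (1 - \<delta> / (2 * (1 - q)))"
  define P where "P = two_point q h l"
  have P: "P \<in> mean_MAD_set \<mu> (\<delta> * \<mu>)"
    unfolding P_def h_def l_def using assms by (intro two_point_in_mean_MAD_set) auto
  have le: "OPT_REV_ratio (\<rho> * \<mu>) P \<le> worst_case_ratio \<mu> (\<delta> * \<mu>) (\<rho> * \<mu>)"
    unfolding worst_case_ratio_def using P by (rule SUP_upper)
  have meas: "measure P {s..} = q * indicator {s..} h + (1 - q) * indicator {s..} l" for s
    unfolding P_def using assms by (intro measure_two_point) auto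
  have l_less: "l < \<rho> * \<mu>"
    unfolding l_def using low assms(1) by (simp add: mult.commute)
  have l_le: "l \<le> \<mu>"
    unfolding l_def using assms by (simp add: mult_le_cancel_left1)
  have h_ge: "\<mu> \<le> h"
    unfolding h_def using assms by simp
  have REV_r: "0 \<le> REV (\<rho> * \<mu>) P" "REV (\<rho> * \<mu>) P \<le> \<rho> * \<mu> * q"
    unfolding REV_def meas using l_less assms by (auto simp: indicator_def)
  have "h * q \<le> REV h P"
    unfolding REV_def meas using h_ge assms by (auto simp: indicator_def)
  then have "ereal (h * q / (\<rho> * \<mu> * q)) \<le> OPT_REV_ratio (\<rho> * \<mu>) P"
    using REV_r h_ge assms by (intro ratio_ge_of_REV_ge[of h]) auto
  also have "h * q / (\<rho> * \<mu> * q) = (q + \<delta> / 2) / (\<rho> * q)"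
    unfolding h_def using assms by (simp add: field_simps)
  finally show "ereal ((q + \<delta> / 2) / (\<rho> * q)) \<le> worst_case_ratio \<mu> (\<delta> * \<mu>) (\<rho> * \<mu>)"
    using le by (rule order_trans)
  assume "0 < 1 - \<delta> / (2 * (1 - q))"
  then have l_pos: "0 < l" unfolding l_def using assms(1) by simp
  have "l \<le> REV l P"
    unfolding REV_def meas using l_le h_ge by (simp add: indicator_def)
  then have "ereal (l / (\<rho> * \<mu> * q)) \<le> OPT_REV_ratio (\<rho> * \<mu>) P"
    using REV_r l_pos assms by (intro ratio_ge_of_REV_ge[of l]) auto
  also have "l / (\<rho> * \<mu> * q) = (1 - \<delta> / (2 * (1 - q))) / (\<rho> * q)"
    unfolding l_def using assms by simp
  finally show "ereal ((1 - \<delta> / (2 * (1 - q))) / (\<rho> * q)) \<le> worst_case_ratio \<mu> (\<delta> * \<mu>) (\<rho> * \<mu>)"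
    using le by (rule order_trans)
qed

section \<open>The worst-case ratio as a function of the price\<close>

text \<open>
  The greatest lower bound on the probability of a sale at price \<open>\<rho> * \<mu>\<close> that mean and mean
  absolute deviation imply. It is meaningful only for \<open>\<rho> < 1 - \<delta> / 2\<close>, where it is positive.
\<close>

definition min_sale :: "real \<Rightarrow> real \<Rightarrow> real" where
  "min_sale \<delta> \<rho> = 1 - \<delta> / (2 * (1 - \<rho>))"

text \<open>
  The worst ratio against an optimal price above, respectively below, the price \<open>\<rho> * \<mu>\<close>.
\<close>

definition higher_price_ratio :: "real \<Rightarrow> real \<Rightarrow> real" where
  "higher_price_ratio \<delta> \<rho> = (min_sale \<delta> \<rho> + \<delta> / 2) / (\<rho> * min_sale \<delta> \<rho>)"

definition lower_price_ratio :: "real \<Rightarrow> real \<Rightarrow> real" where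
  "lower_price_ratio \<delta> \<rho> = 1 / min_sale \<delta> \<rho>"

lemma min_sale_pos:
  assumes "0 \<le> \<delta>" "\<rho> < 1 - \<delta> / 2"
  shows "0 < min_sale \<delta> \<rho>"
proof -
  have "\<delta> < 2 * (1 - \<rho>)" "0 < 2 * (1 - \<rho>)" using assms by auto
  then show ?thesis by (simp add: min_sale_def)
qed

text \<open>
  Both bounds on the ratio depend on the distribution only through the sale probability \<open>q\<close> and
  do not increase in it, so the guaranteed value \<open>min_sale\<close> may be inserted.
\<close>

lemma worst_case_ratio_le:
  assumes "0 < \<mu>" "0 \<le> \<delta>" "0 < \<rho>" "\<rho> < 1 - \<delta> / 2"
  shows "worst_case_ratio \<mu> (\<delta> * \<mu>) (\<rho> * \<mu>)
    \<le> ereal (max (higher_price_ratio \<delta> \<rho>) (lower_price_ratio \<delta> \<rho>))"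
  unfolding worst_case_ratio_def
proof (rule SUP_least)
  fix P assume P: "P \<in> mean_MAD_set \<mu> (\<delta> * \<mu>)"
  define q where "q = measure P {\<rho> * \<mu>..}"
  let ?k = "min_sale \<delta> \<rho>"
  have k: "0 < ?k" using assms by (intro min_sale_pos)
  have "\<rho> * \<mu> < \<mu>" using assms by simp
  from sale_probability_lower_bound[OF P this]
  have "1 - \<delta> * \<mu> / (2 * (\<mu> - \<rho> * \<mu>)) \<le> q" by (simp add: q_def)
  also have "\<delta> * \<mu> / (2 * (\<mu> - \<rho> * \<mu>)) = \<delta> / (2 * (1 - \<rho>))"
  proof -
    have "2 * (\<mu> - \<rho> * \<mu>) = (2 * (1 - \<rho>)) * \<mu>" by (simp add: algebra_simps)
    then show ?thesis using assms by simp
  qed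
  finally have kq: "?k \<le> q" by (simp add: min_sale_def)
  then have q: "0 < q" using k by simp
  have REV: "REV (\<rho> * \<mu>) P = \<rho> * \<mu> * q" by (simp add: REV_def q_def)
  have pos: "0 < \<rho> * \<mu> * q" using assms q by simp
  have "OPT_REV_ratio (\<rho> * \<mu>) P = OPT P / ereal (\<rho> * \<mu> * q)"
    unfolding OPT_REV_ratio_def REV using pos by auto
  also have "\<dots> \<le> ereal (max (\<rho> * \<mu>) (\<mu> * q + \<delta> * \<mu> / 2)) / ereal (\<rho> * \<mu> * q)"
    using OPT_le[OF P, of "\<rho> * \<mu>"] assms(1) pos
    by (intro ereal_divide_right_mono) (auto simp: q_def)
  also have "\<dots> = ereal (max (\<rho> * \<mu>) (\<mu> * q + \<delta> * \<mu> / 2) / (\<rho> * \<mu> * q))"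
    using pos by (auto simp: max_def)
  also have "max (\<rho> * \<mu>) (\<mu> * q + \<delta> * \<mu> / 2) / (\<rho> * \<mu> * q)
      = max (\<rho> * \<mu> / (\<rho> * \<mu> * q)) ((\<mu> * q + \<delta> * \<mu> / 2) / (\<rho> * \<mu> * q))"
    by (simp only: max_divide_distrib_right less_imp_le[OF pos] if_True)
  also have "\<rho> * \<mu> / (\<rho> * \<mu> * q) = 1 / q" using assms by simp
  also have "(\<mu> * q + \<delta> * \<mu> / 2) / (\<rho> * \<mu> * q) = (1 + \<delta> / 2 * (1 / q)) / \<rho>"
    using assms q by (simp add: field_simps)
  finally have ratio: "OPT_REV_ratio (\<rho> * \<mu>) P \<le> ereal (max (1 / q) ((1 + \<delta> / 2 * (1 / q)) / \<rho>))" .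
  have inv: "1 / q \<le> 1 / ?k" using kq k by (simp add: frac_le)
  have "(1 + \<delta> / 2 * (1 / q)) / \<rho> \<le> (1 + \<delta> / 2 * (1 / ?k)) / \<rho>"
    using inv assms by (intro divide_right_mono add_left_mono mult_left_mono) auto
  also have "\<dots> = higher_price_ratio \<delta> \<rho>"
    unfolding higher_price_ratio_def using k assms by (simp add: field_simps)
  finally have "max (1 / q) ((1 + \<delta> / 2 * (1 / q)) / \<rho>)
      \<le> max (higher_price_ratio \<delta> \<rho>) (lower_price_ratio \<delta> \<rho>)"
    using inv unfolding lower_price_ratio_def by (simp only: max.commute[of "1 / q"] max.mono)
  then have "ereal (max (1 / q) ((1 + \<delta> / 2 * (1 / q)) / \<rho>))
      \<le> ereal (max (higher_price_ratio \<delta> \<rho>) (lower_price_ratio \<delta> \<rho>))"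
    by (simp only: ereal_less_eq(3))
  with ratio show "OPT_REV_ratio (\<rho> * \<mu>) P
      \<le> ereal (max (higher_price_ratio \<delta> \<rho>) (lower_price_ratio \<delta> \<rho>))"
    by (rule order_trans)
qed

text \<open>
  At \<open>q = min_sale \<delta> \<rho>\<close> the lower point of the two-point distribution would coincide with the
  price, and everybody would buy. The bounds are therefore only approached, by letting \<open>q\<close>
  tend to \<open>min_sale \<delta> \<rho>\<close> from above.
\<close>

lemma worst_case_ratio_ge:
  assumes "0 < \<mu>" "0 < \<delta>" "0 < \<rho>" "\<rho> < 1 - \<delta> / 2"
  shows "ereal (max (higher_price_ratio \<delta> \<rho>) (lower_price_ratio \<delta> \<rho>))
    \<le> worst_case_ratio \<mu> (\<delta> * \<mu>) (\<rho> * \<mu>)"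
proof -
  let ?k = "min_sale \<delta> \<rho>" and ?W = "worst_case_ratio \<mu> (\<delta> * \<mu>) (\<rho> * \<mu>)"
  let ?l = "\<lambda>q. 1 - \<delta> / (2 * (1 - q))"
  have k: "0 < ?k" using assms by (intro min_sale_pos) auto
  have k1: "?k < 1" using assms by (simp add: min_sale_def)
  have lk: "?l ?k = \<rho>" using assms by (simp add: min_sale_def, simp add: field_simps)
  have lim_l: "(?l \<longlongrightarrow> \<rho>) (at_right ?k)"
    using k1 by (subst lk[symmetric]) (intro tendsto_intros, auto)
  have l_less: "?l q < \<rho>" if "?k < q" "q < 1" for q
  proof -
    have "\<delta> / (2 * (1 - ?k)) < \<delta> / (2 * (1 - q))"
      using that assms by (intro divide_strict_left_mono) auto
    then show ?thesis using lk by simp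
  qed
  have near: "\<forall>\<^sub>F q in at_right ?k. ?k < q \<and> q < 1"
    using k1 by (auto simp: eventually_at_right_field)
  have high: "((\<lambda>q. ereal ((q + \<delta> / 2) / (\<rho> * q))) \<longlongrightarrow> ereal (higher_price_ratio \<delta> \<rho>)) (at_right ?k)"
    unfolding higher_price_ratio_def using k assms by (auto intro!: tendsto_intros)
  have "((\<lambda>q. ?l q / (\<rho> * q)) \<longlongrightarrow> \<rho> / (\<rho> * ?k)) (at_right ?k)"
    using k assms by (intro tendsto_divide lim_l tendsto_intros) auto
  then have low: "((\<lambda>q. ereal (?l q / (\<rho> * q))) \<longlongrightarrow> ereal (lower_price_ratio \<delta> \<rho>)) (at_right ?k)"
    unfolding lower_price_ratio_def using assms by simp
  have "ereal (higher_price_ratio \<delta> \<rho>) \<le> ?W"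
    using k assms l_less
    by (intro tendsto_upperbound[OF high] eventually_mono[OF near] worst_case_ratio_ge_two_point) auto
  moreover have "ereal (lower_price_ratio \<delta> \<rho>) \<le> ?W"
  proof (rule tendsto_upperbound[OF low])
    have "\<forall>\<^sub>F q in at_right ?k. 0 < ?l q"
      using lim_l assms(3) by (rule order_tendstoD(1))
    with near show "\<forall>\<^sub>F q in at_right ?k. ereal (?l q / (\<rho> * q)) \<le> ?W"
    proof eventually_elim
      case (elim q)
      then show ?case using k assms l_less[of q]
        by (intro worst_case_ratio_ge_two_point(2)) auto
    qed
  qed simp
  ultimately show ?thesis by (simp add: max_def)
qed

lemma worst_case_ratio_eq:
  assumes "0 < \<mu>" "0 < \<delta>" "0 < \<rho>" "\<rho> < 1 - \<delta> / 2"
  shows "worst_case_ratio \<mu> (\<delta> * \<mu>) (\<rho> * \<mu>)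
    = ereal (max (higher_price_ratio \<delta> \<rho>) (lower_price_ratio \<delta> \<rho>))"
  using worst_case_ratio_le[of \<mu> \<delta> \<rho>] worst_case_ratio_ge[OF assms] assms by (intro antisym) auto

text \<open>
  As \<open>q\<close> tends to \<open>0\<close> the lower point \<open>\<mu> * (1 - \<delta> / (2 * (1 - q)))\<close> stays below
  \<open>\<mu> * (1 - \<delta> / 2)\<close>, while the upper point alone always earns more than \<open>\<delta> * \<mu> / 2\<close>: sales at
  the price \<open>\<rho> * \<mu>\<close> vanish but the optimal revenue does not.
\<close>

lemma worst_case_ratio_infinite:
  assumes "0 < \<mu>" "0 < \<delta>" "0 < \<rho>" "1 - \<delta> / 2 \<le> \<rho>"
  shows "worst_case_ratio \<mu> (\<delta> * \<mu>) (\<rho> * \<mu>) = \<infinity>"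
proof (rule ereal_top)
  fix B :: real
  \<comment> \<open>small enough that \<open>\<delta> / (2 * \<rho> * q)\<close>, a lower bound for the ratio, exceeds \<open>B\<close>\<close>
  define q where "q = min (1 / 2) (\<delta> / (2 * \<rho> * (\<bar>B\<bar> + 1)))"
  have q: "0 < q" "q < 1" and qB: "q \<le> \<delta> / (2 * \<rho> * (\<bar>B\<bar> + 1))"
    using assms by (auto simp: q_def)
  have "\<delta> / 2 < \<delta> / (2 * (1 - q))"
    using q assms by (intro divide_strict_left_mono) auto
  then have "1 - \<delta> / (2 * (1 - q)) < \<rho>" using assms by simp
  then have W: "ereal ((q + \<delta> / 2) / (\<rho> * q)) \<le> worst_case_ratio \<mu> (\<delta> * \<mu>) (\<rho> * \<mu>)"
    using q assms by (intro worst_case_ratio_ge_two_point) auto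
  have "q * (2 * \<rho> * (\<bar>B\<bar> + 1)) \<le> \<delta>"
    using qB assms by (simp add: pos_le_divide_eq)
  then have "(\<bar>B\<bar> + 1) * (\<rho> * q) \<le> q + \<delta> / 2"
    using q by (simp add: algebra_simps)
  then have "\<bar>B\<bar> + 1 \<le> (q + \<delta> / 2) / (\<rho> * q)"
    using q assms by (simp add: pos_le_divide_eq)
  then have "ereal B \<le> ereal ((q + \<delta> / 2) / (\<rho> * q))" by simp
  then show "ereal B \<le> worst_case_ratio \<mu> (\<delta> * \<mu>) (\<rho> * \<mu>)" using W by (rule order_trans)
qed

text \<open>
  With zero mean absolute deviation demand is almost surely \<open>\<mu>\<close>. A lower price wastes the factor
  \<open>\<mu> / r\<close>, and at a higher price nobody buys.
\<close>

lemma worst_case_ratio_no_dispersion: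
  assumes "0 < \<mu>"
  shows "worst_case_ratio \<mu> 0 \<mu> = 1"
    and "0 < r \<Longrightarrow> r \<noteq> \<mu> \<Longrightarrow> 1 < worst_case_ratio \<mu> 0 r"
proof -
  define D where "D = two_point (1 / 2) \<mu> \<mu>"
  have D: "D \<in> mean_MAD_set \<mu> 0"
    using two_point_in_mean_MAD_set[of \<mu> 0 "1 / 2"] assms by (simp add: D_def)
  have ge: "OPT_REV_ratio r D \<le> worst_case_ratio \<mu> 0 r" for r
    unfolding worst_case_ratio_def using D by (rule SUP_upper)
  have meas: "measure D {s..} = indicator {s..} \<mu>" for s
    by (simp add: D_def measure_two_point)
  have D_ratio: "ereal (\<mu> / r) \<le> OPT_REV_ratio r D" if "0 < r" for r
    using that assms
    by (intro ratio_ge_of_REV_ge[of \<mu>]) (auto simp: REV_def meas indicator_def)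
  show "1 < worst_case_ratio \<mu> 0 r" if r: "0 < r" "r \<noteq> \<mu>"
  proof (cases "r < \<mu>")
    case True
    then have "1 < ereal (\<mu> / r)" using r by (simp add: one_ereal_def)
    also have "\<dots> \<le> worst_case_ratio \<mu> 0 r"
      using D_ratio[OF r(1)] ge by (rule order_trans)
    finally show ?thesis .
  next
    case False
    then have "OPT_REV_ratio r D = \<infinity>"
      using r by (simp add: OPT_REV_ratio_def REV_def meas indicator_def)
    then show ?thesis using ge[of r] by (simp add: one_ereal_def)
  qed
  show "worst_case_ratio \<mu> 0 \<mu> = 1"
  proof (rule antisym)
    show "1 \<le> worst_case_ratio \<mu> 0 \<mu>"
      using order_trans[OF D_ratio[OF assms] ge] assms by (simp add: one_ereal_def)
    show "worst_case_ratio \<mu> 0 \<mu> \<le> 1"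
      unfolding worst_case_ratio_def
    proof (rule SUP_least)
      fix P assume P: "P \<in> mean_MAD_set \<mu> 0"
      interpret real_distribution P by (rule mean_MAD_setD(1)[OF P])
      have "AE x in P. \<bar>x - \<mu>\<bar> = 0"
        using mean_MAD_setD(2,4)[OF P]
        by (subst integral_nonneg_eq_0_iff_AE[symmetric]) auto
      then have one: "measure P {\<mu>..} = 1"
        by (subst prob_eq_1) auto
      have "OPT_REV_ratio \<mu> P = OPT P / ereal \<mu>"
        using one assms by (simp add: OPT_REV_ratio_def REV_def)
      also have "\<dots> \<le> ereal \<mu> / ereal \<mu>"
        using OPT_le[OF P, of \<mu>] one assms by (intro ereal_divide_right_mono) auto
      also have "\<dots> = 1" using assms by (simp add: one_ereal_def)
      finally show "OPT_REV_ratio \<mu> P \<le> 1" .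
    qed
  qed
qed

section \<open>Minimising over the price\<close>

lemma ratio_closed_forms:
  assumes "0 \<le> \<delta>" "0 < \<rho>" "\<rho> < 1 - \<delta> / 2"
  shows "higher_price_ratio \<delta> \<rho> = (2 - (2 + \<delta>) * \<rho>) / (\<rho> * (2 - \<delta> - 2 * \<rho>))"
    and "lower_price_ratio \<delta> \<rho> = 2 * (1 - \<rho>) / (2 - \<delta> - 2 * \<rho>)"
proof -
  have pos: "0 < 1 - \<rho>" "0 < 2 - \<delta> - 2 * \<rho>" using assms by auto
  have k: "min_sale \<delta> \<rho> = (2 - \<delta> - 2 * \<rho>) / (2 * (1 - \<rho>))"
    unfolding min_sale_def using pos by (simp add: field_simps)
  show "lower_price_ratio \<delta> \<rho> = 2 * (1 - \<rho>) / (2 - \<delta> - 2 * \<rho>)"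
    unfolding lower_price_ratio_def k by simp
  have "min_sale \<delta> \<rho> + \<delta> / 2 = (2 - (2 + \<delta>) * \<rho>) / (2 * (1 - \<rho>))"
    unfolding k using pos by (simp add: field_simps)
  then show "higher_price_ratio \<delta> \<rho> = (2 - (2 + \<delta>) * \<rho>) / (\<rho> * (2 - \<delta> - 2 * \<rho>))"
    unfolding higher_price_ratio_def using pos assms unfolding k by simp
qed

text \<open>
  Over the common denominator \<open>\<rho> * (2 - \<delta> - 2 * \<rho>)\<close> the comparison becomes quadratic in \<open>\<rho>\<close>.
\<close>

lemma lower_le_higher_price_ratio_iff:
  assumes "0 \<le> \<delta>" "0 < \<rho>" "\<rho> < 1 - \<delta> / 2"
  shows "lower_price_ratio \<delta> \<rho> \<le> higher_price_ratio \<delta> \<rho> \<longleftrightarrow> \<delta> * \<rho> \<le> 2 * (1 - \<rho>)\<^sup>2"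
proof -
  have y: "0 < 2 - \<delta> - 2 * \<rho>" using assms by simp
  then have pos: "0 < \<rho> * (2 - \<delta> - 2 * \<rho>)" using assms by simp
  have cancel: "a / c \<le> b / c \<longleftrightarrow> a \<le> b" if "0 < c" for a b c :: real
    using that by (simp add: divide_le_cancel)
  have "lower_price_ratio \<delta> \<rho> = \<rho> * (2 * (1 - \<rho>)) / (\<rho> * (2 - \<delta> - 2 * \<rho>))"
    unfolding ratio_closed_forms(2)[OF assms] using assms by simp
  then have "lower_price_ratio \<delta> \<rho> \<le> higher_price_ratio \<delta> \<rho> \<longleftrightarrow>
      \<rho> * (2 * (1 - \<rho>)) \<le> 2 - (2 + \<delta>) * \<rho>"
    by (simp only: ratio_closed_forms(1)[OF assms] cancel[OF pos])
  also have "\<dots> \<longleftrightarrow> \<delta> * \<rho> \<le> 2 * (1 - \<rho>)\<^sup>2"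
    by (simp add: power2_eq_square algebra_simps)
  finally show ?thesis .
qed

lemma lower_price_ratio_strict_mono:
  assumes "0 < \<delta>" "\<rho> < \<rho>'" "\<rho>' < 1 - \<delta> / 2"
  shows "lower_price_ratio \<delta> \<rho> < lower_price_ratio \<delta> \<rho>'"
proof -
  have "min_sale \<delta> \<rho>' < min_sale \<delta> \<rho>"
    unfolding min_sale_def using assms
    by (intro diff_strict_left_mono divide_strict_left_mono) auto
  then show ?thesis
    unfolding lower_price_ratio_def using assms min_sale_pos[of \<delta> \<rho>']
    by (intro divide_strict_left_mono) auto
qed

text \<open>
  The excess over the claimed minimum is a perfect square over a positive denominator. It shows
  at once that \<open>(2 - \<delta>) / (2 + \<delta>)\<close> is the only minimiser. The minimum value equals
  \<open>(2 + \<delta>)\<^sup>2 / (2 - \<delta>)\<^sup>2\<close>.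
\<close>

lemma higher_price_ratio_minus_minimum:
  assumes "0 \<le> \<delta>" "0 < \<rho>" "\<rho> < 1 - \<delta> / 2"
  shows "higher_price_ratio \<delta> \<rho> - (1 + 8 * \<delta> / (2 - \<delta>)\<^sup>2)
    = 2 * ((2 + \<delta>) * \<rho> - (2 - \<delta>))\<^sup>2 / ((2 - \<delta>)\<^sup>2 * (\<rho> * (2 - \<delta> - 2 * \<rho>)))"
proof -
  have nz: "2 - \<delta> \<noteq> 0" "\<rho> \<noteq> 0" "2 - \<delta> - 2 * \<rho> \<noteq> 0" using assms by auto
  then have denom: "\<rho> * (2 - \<delta> - 2 * \<rho>) \<noteq> 0" "(2 - \<delta>)\<^sup>2 \<noteq> 0" by auto
  have "(2 + \<delta>)\<^sup>2 = (2 - \<delta>)\<^sup>2 + 8 * \<delta>" by algebra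
  then have "1 + 8 * \<delta> / (2 - \<delta>)\<^sup>2 = (2 + \<delta>)\<^sup>2 / (2 - \<delta>)\<^sup>2"
    using nz(1) by (simp add: add_divide_distrib)
  then have "higher_price_ratio \<delta> \<rho> - (1 + 8 * \<delta> / (2 - \<delta>)\<^sup>2)
    = ((2 - (2 + \<delta>) * \<rho>) * (2 - \<delta>)\<^sup>2 - (2 + \<delta>)\<^sup>2 * (\<rho> * (2 - \<delta> - 2 * \<rho>)))
        / ((\<rho> * (2 - \<delta> - 2 * \<rho>)) * (2 - \<delta>)\<^sup>2)"
    by (simp only: ratio_closed_forms(1)[OF assms] diff_frac_eq[OF denom])
  also have "(2 - (2 + \<delta>) * \<rho>) * (2 - \<delta>)\<^sup>2 - (2 + \<delta>)\<^sup>2 * (\<rho> * (2 - \<delta> - 2 * \<rho>))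
      = 2 * ((2 + \<delta>) * \<rho> - (2 - \<delta>))\<^sup>2"
    by algebra
  finally show ?thesis by (simp only: mult.commute)
qed

text \<open>
  This concerns the range to the left of the minimiser \<open>(2 - \<delta>) / (2 + \<delta>)\<close>. There
  \<open>\<delta> * \<rho> \<le> 2 - \<delta> - 2 * \<rho>\<close>, and the difference of the two ratios has the sign of
  \<open>(2 - \<delta> - 2 * \<rho>) * (2 - \<delta> - 2 * \<rho>') - (\<delta> * \<rho>) * (\<delta> * \<rho>')\<close>.
\<close>

lemma higher_price_ratio_strict_decreasing:
  assumes "0 < \<delta>" "0 < \<rho>" "\<rho> < \<rho>'" "\<rho>' < 1 - \<delta> / 2" "(2 + \<delta>) * \<rho>' \<le> 2 - \<delta>"
  shows "higher_price_ratio \<delta> \<rho>' < higher_price_ratio \<delta> \<rho>"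
proof -
  let ?y = "2 - \<delta> - 2 * \<rho>" and ?y' = "2 - \<delta> - 2 * \<rho>'"
  have pos: "0 < ?y" "0 < ?y'" "0 < \<rho>'" "0 < 2 - \<delta>" using assms by auto
  have "\<delta> * \<rho> < \<delta> * \<rho>'" using assms by simp
  moreover have y': "\<delta> * \<rho>' \<le> ?y'" using assms by (simp add: algebra_simps)
  ultimately have y: "\<delta> * \<rho> < ?y" using assms(3) by linarith
  have "(\<delta> * \<rho>) * (\<delta> * \<rho>') < ?y * ?y'"
    using y y' assms pos by (intro mult_less_le_imp_less) auto
  then have "0 < 2 * (\<rho>' - \<rho>) * (?y * ?y' - (\<delta> * \<rho>) * (\<delta> * \<rho>'))"
    using assms by simp
  also have "\<dots> = (2 - \<delta>) * ((2 - (2 + \<delta>) * \<rho>) * (\<rho>' * ?y') - (2 - (2 + \<delta>) * \<rho>') * (\<rho> * ?y))"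
    by algebra
  finally have "(2 - (2 + \<delta>) * \<rho>') * (\<rho> * ?y) < (2 - (2 + \<delta>) * \<rho>) * (\<rho>' * ?y')"
    using pos by (simp add: zero_less_mult_iff)
  then have "(2 - (2 + \<delta>) * \<rho>') / (\<rho>' * ?y') < (2 - (2 + \<delta>) * \<rho>) / (\<rho> * ?y)"
    using pos assms by (simp add: divide_less_eq less_divide_eq)
  then show ?thesis using assms by (simp add: ratio_closed_forms)
qed

text \<open>
  Strictness away from \<open>\<rho>\<^sub>0\<close> makes the minimiser unique, and attainment makes the infimum over
  scaled prices equal to the value there.
\<close>

lemma strict_minimiser_is_arg_min_and_INF:
  fixes W :: "real \<Rightarrow> ereal" and \<mu> \<rho>\<^sub>0 v :: real
  assumes "0 < \<mu>" "0 < \<rho>\<^sub>0" "W (\<rho>\<^sub>0 * \<mu>) = ereal v"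
    and less: "\<And>\<rho>. 0 < \<rho> \<Longrightarrow> \<rho> \<noteq> \<rho>\<^sub>0 \<Longrightarrow> ereal v < W (\<rho> * \<mu>)"
  shows "(\<forall>r. is_arg_min W (\<lambda>r. 0 < r) r \<longleftrightarrow> r / \<mu> = \<rho>\<^sub>0) \<and>
    (INF \<rho>\<in>{0<..}. W (\<rho> * \<mu>)) = ereal v"
proof (intro conjI allI)
  have le: "ereal v \<le> W (\<rho> * \<mu>)" if "0 < \<rho>" for \<rho>
    using less[OF that] assms(3) by (cases "\<rho> = \<rho>\<^sub>0") auto
  show "(INF \<rho>\<in>{0<..}. W (\<rho> * \<mu>)) = ereal v"
    using assms(2,3) le by (intro antisym INF_greatest) (auto intro: INF_lower2)
  fix r
  define \<rho> where "\<rho> = r / \<mu>"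
  have r: "r = \<rho> * \<mu>" using assms(1) by (simp add: \<rho>_def)
  have sgn: "0 < r \<longleftrightarrow> 0 < \<rho>" unfolding r using assms(1) by (simp add: zero_less_mult_iff)
  show "is_arg_min W (\<lambda>r. 0 < r) r \<longleftrightarrow> r / \<mu> = \<rho>\<^sub>0"
  proof
    assume "is_arg_min W (\<lambda>r. 0 < r) r"
    then have "0 < \<rho>" "\<not> W (\<rho>\<^sub>0 * \<mu>) < W r"
      using sgn assms(1,2) by (auto simp: is_arg_min_def)
    then have "0 < \<rho>" "\<not> ereal v < W (\<rho> * \<mu>)"
      unfolding assms(3) r by blast+
    then have "\<rho> = \<rho>\<^sub>0" using less by blast
    then show "r / \<mu> = \<rho>\<^sub>0" by (simp only: \<rho>_def)
  next
    assume "r / \<mu> = \<rho>\<^sub>0"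
    then have r0: "r = \<rho>\<^sub>0 * \<mu>" using assms(1) by (auto simp: field_simps)
    have "\<not> W s < ereal v" if "0 < s" for s
      using le[of "s / \<mu>"] that assms(1) by simp
    then show "is_arg_min W (\<lambda>r. 0 < r) r"
      using assms(1-3) by (auto simp: is_arg_min_def r0)
  qed
qed

text \<open>
  The smaller root of \<open>2 * (1 - \<rho>)\<^sup>2 = \<delta> * \<rho>\<close>, where the two ratios cross.
\<close>

lemma quadratic_crossing:
  fixes \<delta> :: real
  assumes "0 \<le> \<delta>"
  defines "\<rho> \<equiv> (4 + \<delta> - sqrt (\<delta>\<^sup>2 + 8 * \<delta>)) / 4"
  shows "0 < \<rho>" "\<rho> \<le> 1" "\<delta> * \<rho> = 2 * (1 - \<rho>)\<^sup>2"
proof -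
  define s where "s = sqrt (\<delta>\<^sup>2 + 8 * \<delta>)"
  have s2: "s\<^sup>2 = \<delta>\<^sup>2 + 8 * \<delta>" using assms(1) by (simp add: s_def)
  have "s < 4 + \<delta>"
    unfolding s_def using assms(1) by (intro real_less_lsqrt) (auto simp: power2_eq_square algebra_simps)
  then show "0 < \<rho>" by (simp add: \<rho>_def s_def)
  have "\<delta> \<le> s" unfolding s_def using assms(1) by (intro real_le_rsqrt) simp
  then show "\<rho> \<le> 1" by (simp add: \<rho>_def s_def)
  have s: "s = 4 + \<delta> - 4 * \<rho>" unfolding \<rho>_def s_def by (simp add: field_simps)
  show "\<delta> * \<rho> = 2 * (1 - \<rho>)\<^sup>2"
    using s2 unfolding s by algebra
qed

text \<open>
  The threshold is the positive root of \<open>\<delta>\<^sup>2 + 8 * \<delta> - 4\<close>, the polynomial that decides whether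
  the crossing point lies to the left of the minimiser \<open>(2 - \<delta>) / (2 + \<delta>)\<close>.
\<close>

lemma threshold_iff:
  fixes \<delta> :: real
  assumes "0 \<le> \<delta>"
  shows "\<delta> \<le> 2 * (sqrt 5 - 2) \<longleftrightarrow> \<delta>\<^sup>2 + 8 * \<delta> \<le> 4"
    and "2 * (sqrt 5 - 2) \<le> \<delta> \<longleftrightarrow> 4 \<le> \<delta>\<^sup>2 + 8 * \<delta>"
proof -
  have root: "sqrt ((\<delta> / 2 + 2)\<^sup>2) = \<delta> / 2 + 2" using assms by simp
  have "\<delta> \<le> 2 * (sqrt 5 - 2) \<longleftrightarrow> \<delta> / 2 + 2 \<le> sqrt 5" by auto
  also have "\<dots> \<longleftrightarrow> (\<delta> / 2 + 2)\<^sup>2 \<le> 5"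
    using real_sqrt_le_iff[of "(\<delta> / 2 + 2)\<^sup>2" 5] by (simp only: root)
  finally show "\<delta> \<le> 2 * (sqrt 5 - 2) \<longleftrightarrow> \<delta>\<^sup>2 + 8 * \<delta> \<le> 4"
    by (simp add: power2_eq_square field_simps)
  have "2 * (sqrt 5 - 2) \<le> \<delta> \<longleftrightarrow> sqrt 5 \<le> \<delta> / 2 + 2" by auto
  also have "\<dots> \<longleftrightarrow> 5 \<le> (\<delta> / 2 + 2)\<^sup>2"
    using real_sqrt_le_iff[of 5 "(\<delta> / 2 + 2)\<^sup>2"] by (simp only: root)
  finally show "2 * (sqrt 5 - 2) \<le> \<delta> \<longleftrightarrow> 4 \<le> \<delta>\<^sup>2 + 8 * \<delta>"
    by (simp add: power2_eq_square field_simps)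
qed

text \<open>
  For small \<open>\<delta>\<close> the crossing point comes before the minimiser of the ratio against higher prices.
  Left of the crossing that ratio still decreases; right of it the ratio against lower prices
  increases. So the larger of the two is smallest exactly at the crossing.
\<close>

lemma optimal_price_small_dispersion:
  fixes \<mu> \<delta> :: real
  assumes "0 < \<mu>" "0 < \<delta>" "\<delta>\<^sup>2 + 8 * \<delta> \<le> 4"
  defines "\<rho>\<^sub>0 \<equiv> (4 + \<delta> - sqrt (\<delta>\<^sup>2 + 8 * \<delta>)) / 4"
    and "v \<equiv> 1 + 2 * \<delta> / (sqrt (\<delta>\<^sup>2 + 8 * \<delta>) - 3 * \<delta>)"
  shows "0 < \<rho>\<^sub>0" "worst_case_ratio \<mu> (\<delta> * \<mu>) (\<rho>\<^sub>0 * \<mu>) = ereal v"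
    and "0 < \<rho> \<Longrightarrow> \<rho> \<noteq> \<rho>\<^sub>0 \<Longrightarrow> ereal v < worst_case_ratio \<mu> (\<delta> * \<mu>) (\<rho> * \<mu>)"
proof -
  define s where "s = sqrt (\<delta>\<^sup>2 + 8 * \<delta>)"
  have s: "s = 4 + \<delta> - 4 * \<rho>\<^sub>0" unfolding \<rho>\<^sub>0_def s_def by (simp add: field_simps)
  have pos: "0 < \<rho>\<^sub>0" and le1: "\<rho>\<^sub>0 \<le> 1" and cross: "\<delta> * \<rho>\<^sub>0 = 2 * (1 - \<rho>\<^sub>0)\<^sup>2"
    using quadratic_crossing[of \<delta>] assms(2) unfolding \<rho>\<^sub>0_def by auto
  show "0 < \<rho>\<^sub>0" by (rule pos)
  have "\<delta> < 1"
    using assms(2,3) zero_le_power2[of \<delta>] by linarith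
  then have "\<delta> * \<delta> < \<delta>" using assms(2) by simp
  then have "3 * \<delta> < s"
    unfolding s_def using assms(2) by (intro real_less_rsqrt) (simp add: power2_eq_square)
  then have below: "\<rho>\<^sub>0 < 1 - \<delta> / 2" unfolding s by simp
  \<comment> \<open>The crossing point is not beyond the minimiser \<open>(2 - \<delta>) / (2 + \<delta>)\<close>: beyond it
      \<open>2 * (1 - \<rho>)\<^sup>2\<close> has already dropped below \<open>\<delta> * \<rho>\<close>.\<close>
  have left: "(2 + \<delta>) * \<rho>\<^sub>0 \<le> 2 - \<delta>"
  proof (rule ccontr)
    assume "\<not> ?thesis"
    then have a: "(2 + \<delta>) * (1 - \<rho>\<^sub>0) < 2 * \<delta>" "2 - \<delta> < (2 + \<delta>) * \<rho>\<^sub>0"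
      by (auto simp: algebra_simps)
    have "2 * ((2 + \<delta>) * (1 - \<rho>\<^sub>0))\<^sup>2 < 2 * (2 * \<delta>)\<^sup>2"
      using a(1) le1 assms(2) by (intro mult_strict_left_mono power_strict_mono) auto
    also have "\<dots> = \<delta> * (8 * \<delta>)" by (simp add: power2_eq_square)
    also have "\<dots> \<le> \<delta> * (4 - \<delta>\<^sup>2)"
      using assms(2,3) by (intro mult_left_mono) auto
    also have "\<dots> = \<delta> * (2 + \<delta>) * (2 - \<delta>)" by (simp add: power2_eq_square algebra_simps)
    also have "\<dots> < \<delta> * (2 + \<delta>) * ((2 + \<delta>) * \<rho>\<^sub>0)"
      using a(2) assms(2) by (intro mult_strict_left_mono) auto
    also have "\<dots> = 2 * ((2 + \<delta>) * (1 - \<rho>\<^sub>0))\<^sup>2"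
      using cross by algebra
    finally show False by simp
  qed
  have low: "lower_price_ratio \<delta> \<rho>\<^sub>0 = v"
  proof -
    have "s - 3 * \<delta> \<noteq> 0" using \<open>3 * \<delta> < s\<close> by simp
    then have "v = (s - \<delta>) / (s - 3 * \<delta>)"
      unfolding v_def s_def[symmetric] by (simp add: field_simps)
    also have "\<dots> = 2 * (1 - \<rho>\<^sub>0) / (2 - \<delta> - 2 * \<rho>\<^sub>0)"
    proof -
      have e: "s - \<delta> = 2 * (2 * (1 - \<rho>\<^sub>0))" "s - 3 * \<delta> = 2 * (2 - \<delta> - 2 * \<rho>\<^sub>0)"
        unfolding s by auto
      show ?thesis unfolding e by (rule mult_divide_mult_cancel_left) simp
    qed
    finally show ?thesis using ratio_closed_forms(2)[of \<delta> \<rho>\<^sub>0] pos below assms(2) by simp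
  qed
  have high: "higher_price_ratio \<delta> \<rho>\<^sub>0 = v"
  proof -
    have "2 - (2 + \<delta>) * \<rho>\<^sub>0 = \<rho>\<^sub>0 * (2 * (1 - \<rho>\<^sub>0))"
      using cross by (simp add: power2_eq_square algebra_simps)
    then have "higher_price_ratio \<delta> \<rho>\<^sub>0 = lower_price_ratio \<delta> \<rho>\<^sub>0"
      using ratio_closed_forms[of \<delta> \<rho>\<^sub>0] pos below assms(2) by simp
    with low show ?thesis by simp
  qed
  show "worst_case_ratio \<mu> (\<delta> * \<mu>) (\<rho>\<^sub>0 * \<mu>) = ereal v"
    using worst_case_ratio_eq[OF assms(1,2) pos below] low high by simp
  show "ereal v < worst_case_ratio \<mu> (\<delta> * \<mu>) (\<rho> * \<mu>)" if \<rho>: "0 < \<rho>" "\<rho> \<noteq> \<rho>\<^sub>0"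
  proof (cases "\<rho> < 1 - \<delta> / 2")
    case False
    then show ?thesis using worst_case_ratio_infinite[of \<mu> \<delta> \<rho>] assms \<rho> by simp
  next
    case True
    have "v < max (higher_price_ratio \<delta> \<rho>) (lower_price_ratio \<delta> \<rho>)"
    proof (cases "\<rho> < \<rho>\<^sub>0")
      case True
      then show ?thesis
        using higher_price_ratio_strict_decreasing[OF assms(2) \<rho>(1) True below left] high by simp
    next
      case False
      then show ?thesis
        using lower_price_ratio_strict_mono[OF assms(2) _ True, of \<rho>\<^sub>0] low \<rho> by simp
    qed
    then show ?thesis
      using worst_case_ratio_eq[OF assms(1,2) \<rho>(1) True] by (simp add: less_max_iff_disj)
  qed
qed

text \<open>
  For large \<open>\<delta>\<close> the ratio against higher prices reaches its minimum before the crossing, where it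
  is still the larger of the two; so its minimum is that of the maximum.
\<close>

lemma optimal_price_large_dispersion:
  fixes \<mu> \<delta> :: real
  assumes "0 < \<mu>" "0 < \<delta>" "\<delta> < 2" "4 \<le> \<delta>\<^sup>2 + 8 * \<delta>"
  defines "\<rho>\<^sub>1 \<equiv> (2 - \<delta>) / (2 + \<delta>)" and "v \<equiv> 1 + 8 * \<delta> / (2 - \<delta>)\<^sup>2"
  shows "0 < \<rho>\<^sub>1" "worst_case_ratio \<mu> (\<delta> * \<mu>) (\<rho>\<^sub>1 * \<mu>) = ereal v"
    and "0 < \<rho> \<Longrightarrow> \<rho> \<noteq> \<rho>\<^sub>1 \<Longrightarrow> ereal v < worst_case_ratio \<mu> (\<delta> * \<mu>) (\<rho> * \<mu>)"
proof -
  show pos: "0 < \<rho>\<^sub>1" using assms by (simp add: \<rho>\<^sub>1_def)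
  have root: "(2 + \<delta>) * \<rho>\<^sub>1 = 2 - \<delta>" using assms(2) by (simp add: \<rho>\<^sub>1_def)
  have below: "\<rho>\<^sub>1 < 1 - \<delta> / 2"
  proof -
    have "\<rho>\<^sub>1 < (2 - \<delta>) / 2"
      unfolding \<rho>\<^sub>1_def using assms by (intro divide_strict_left_mono) auto
    then show ?thesis by simp
  qed
  have high: "higher_price_ratio \<delta> \<rho>\<^sub>1 = v"
    using higher_price_ratio_minus_minimum[of \<delta> \<rho>\<^sub>1] pos below assms(2)
    by (simp add: root v_def)
  \<comment> \<open>Multiplied by \<open>(2 + \<delta>)\<^sup>2\<close>, the comparison of the two ratios at \<open>\<rho>\<^sub>1\<close> is the assumption
      on \<open>\<delta>\<close>.\<close>
  have "\<delta> * (2 + \<delta>)\<^sup>2 * \<rho>\<^sub>1 = \<delta> * (4 - \<delta>\<^sup>2)"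
    using root by algebra
  also have "\<dots> \<le> \<delta> * (8 * \<delta>)"
    using assms(2,4) by (intro mult_left_mono) auto
  also have "\<dots> = 2 * (1 - \<rho>\<^sub>1)\<^sup>2 * (2 + \<delta>)\<^sup>2"
    using root by algebra
  finally have "(\<delta> * \<rho>\<^sub>1) * (2 + \<delta>)\<^sup>2 \<le> 2 * (1 - \<rho>\<^sub>1)\<^sup>2 * (2 + \<delta>)\<^sup>2"
    by (simp add: ac_simps)
  then have "\<delta> * \<rho>\<^sub>1 \<le> 2 * (1 - \<rho>\<^sub>1)\<^sup>2"
    using assms(2) by (simp only: mult_le_cancel_right) auto
  then have "lower_price_ratio \<delta> \<rho>\<^sub>1 \<le> higher_price_ratio \<delta> \<rho>\<^sub>1"
    using lower_le_higher_price_ratio_iff[of \<delta> \<rho>\<^sub>1] pos below assms(2) by simp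
  then show "worst_case_ratio \<mu> (\<delta> * \<mu>) (\<rho>\<^sub>1 * \<mu>) = ereal v"
    using worst_case_ratio_eq[OF assms(1,2) pos below] high by simp
  show "ereal v < worst_case_ratio \<mu> (\<delta> * \<mu>) (\<rho> * \<mu>)" if \<rho>: "0 < \<rho>" "\<rho> \<noteq> \<rho>\<^sub>1"
  proof (cases "\<rho> < 1 - \<delta> / 2")
    case False
    then show ?thesis using worst_case_ratio_infinite[of \<mu> \<delta> \<rho>] assms \<rho> by simp
  next
    case True
    have "(2 + \<delta>) * \<rho> - (2 - \<delta>) \<noteq> 0"
      using \<rho>(2) assms(2) root 
      by (metis eq_iff_diff_eq_0 mult_left_cancel add_pos_pos less_irrefl zero_less_numeral)
    then have "0 < higher_price_ratio \<delta> \<rho> - v"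
      unfolding v_def using higher_price_ratio_minus_minimum[of \<delta> \<rho>] True \<rho>(1) assms(2,3)
      by simp
    then show ?thesis
      using worst_case_ratio_eq[OF assms(1,2) \<rho>(1) True] by (simp add: less_max_iff_disj)
  qed
qed

theorem theorem4p1:
  fixes \<mu> \<delta> :: real
  assumes "0 < \<mu>" and "0 \<le> \<delta>" and "\<delta> < 2"
  shows
    "(\<delta> \<le> 2 * (sqrt 5 - 2) \<longrightarrow>
       (\<forall>r. is_arg_min (worst_case_ratio \<mu> (\<delta> * \<mu>)) (\<lambda>r. 0 < r) r \<longleftrightarrow>
            r / \<mu> = (4 + \<delta> - sqrt (\<delta>\<^sup>2 + 8 * \<delta>)) / 4) \<and>
       (INF \<rho>\<in>{0<..}. worst_case_ratio \<mu> (\<delta> * \<mu>) (\<rho> * \<mu>)) =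
         ereal (1 + (if \<delta> = 0 then 0 else 2 * \<delta> / (sqrt (\<delta>\<^sup>2 + 8 * \<delta>) - 3 * \<delta>)))) \<and>
     (2 * (sqrt 5 - 2) \<le> \<delta> \<longrightarrow>
       (\<forall>r. is_arg_min (worst_case_ratio \<mu> (\<delta> * \<mu>)) (\<lambda>r. 0 < r) r \<longleftrightarrow>
            r / \<mu> = (2 - \<delta>) / (2 + \<delta>)) \<and>
       (INF \<rho>\<in>{0<..}. worst_case_ratio \<mu> (\<delta> * \<mu>) (\<rho> * \<mu>)) =
         ereal (1 + 8 * \<delta> / (2 - \<delta>)\<^sup>2))"
proof (cases "\<delta> = 0")
  case True
  have "\<not> 2 * (sqrt 5 - 2) \<le> \<delta>"
    using threshold_iff(2)[of \<delta>] True by simp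
  moreover have "(\<forall>r. is_arg_min (worst_case_ratio \<mu> (\<delta> * \<mu>)) (\<lambda>r. 0 < r) r \<longleftrightarrow> r / \<mu> = 1) \<and>
      (INF \<rho>\<in>{0<..}. worst_case_ratio \<mu> (\<delta> * \<mu>) (\<rho> * \<mu>)) = ereal 1"
    using worst_case_ratio_no_dispersion[OF assms(1)] assms(1) True
    by (intro strict_minimiser_is_arg_min_and_INF) (auto simp: one_ereal_def[symmetric])
  ultimately show ?thesis using True by simp
next
  case False
  then have \<delta>: "0 < \<delta>" using assms(2) by simp
  let ?W = "worst_case_ratio \<mu> (\<delta> * \<mu>)"
  show ?thesis
  proof (intro conjI[of "_ \<longrightarrow> _" "_ \<longrightarrow> _"] impI)
    assume "\<delta> \<le> 2 * (sqrt 5 - 2)"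
    then have "\<delta>\<^sup>2 + 8 * \<delta> \<le> 4" using threshold_iff(1)[OF assms(2)] by simp
    note opt = optimal_price_small_dispersion[OF assms(1) \<delta> this]
    show "(\<forall>r. is_arg_min ?W (\<lambda>r. 0 < r) r \<longleftrightarrow> r / \<mu> = (4 + \<delta> - sqrt (\<delta>\<^sup>2 + 8 * \<delta>)) / 4) \<and>
      (INF \<rho>\<in>{0<..}. ?W (\<rho> * \<mu>)) =
        ereal (1 + (if \<delta> = 0 then 0 else 2 * \<delta> / (sqrt (\<delta>\<^sup>2 + 8 * \<delta>) - 3 * \<delta>)))"
      using strict_minimiser_is_arg_min_and_INF[of \<mu> _ ?W, OF assms(1) opt] False by simp
  next
    assume "2 * (sqrt 5 - 2) \<le> \<delta>"
    then have "4 \<le> \<delta>\<^sup>2 + 8 * \<delta>" using threshold_iff(2)[OF assms(2)] by simp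
    note opt = optimal_price_large_dispersion[OF assms(1) \<delta> assms(3) this]
    show "(\<forall>r. is_arg_min ?W (\<lambda>r. 0 < r) r \<longleftrightarrow> r / \<mu> = (2 - \<delta>) / (2 + \<delta>)) \<and>
      (INF \<rho>\<in>{0<..}. ?W (\<rho> * \<mu>)) = ereal (1 + 8 * \<delta> / (2 - \<delta>)\<^sup>2)"
      by (rule strict_minimiser_is_arg_min_and_INF[of \<mu> _ ?W, OF assms(1) opt])
  qed
qed

end
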